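(* Let $0<\alpha<1$ be irrational, let $0\le\rho\le1$, and let $z=z(\alpha,\rho)$. Then $z$ is self-shuffling if and only if there exists a sequence $(i_n,j_n)_{n\in\mathbb{N}}$ in $\mathbb{N}^2$ such that (1) $i_n\le i_{n+1}$, $j_n\le j_{n+1}$ and $i_n+j_n=n$ for every $n\in\mathbb{N}$; (2) $\lim_{n\to+\infty}i_n=\lim_{n\to+\infty}j_n=\infty$; and (3) $1_{\{i_n\alpha\}\ge1-\rho}+1_{\{j_n\alpha\}\ge1-\rho}=\lfloor\{i_n\alpha\}+\{j_n\alpha\}+\rho\rfloor$ for every $n\in\mathbb{N}$.
   Context: $\mathbb{N}=\{0,1,2,\dots\}$, $\{t\}=t-\lfloor t\rfloor$ is the fractional part, and for real $x',x''$, $1_{x'\ge x''}$ equals $1$ if $x'\ge x''$ and $0$ otherwise. For irrational $0<\alpha<1$ and $0\le\rho<1$, $z(\alpha,\rho)=z_0z_1z_2\cdots\in\{0,1\}^{\mathbb{N}}$ is the Sturmian word defined by $z_n=\lfloor(n+1)\alpha+\rho\rfloor-\lfloor n\alpha+\rho\rfloor$; $z(\alpha,1)$ is the limit of $z(\alpha,\rho)$ as $\rho\to1$, that is, $z(\alpha,1)_0=1$ and $z(\alpha,1)_n=z(\alpha,0)_n$ for $n\ge1$. An infinite word $x\in\mathbb{A}^{\mathbb{N}}$ is self-shuffling if there exist finite (possibly empty) words $U_i,V_i\in\mathbb{A}^*$ ($i\ge 0$) with $x=\prod_{i=0}^\infty U_iV_i=\prod_{i=0}^\infty U_i=\prod_{i=0}^\infty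 V_i$. *)

theory Defs
  imports "HOL-Analysis.Analysis" "HOL-Library.Omega_Words_Fun"
begin

(* The factors may be empty, so the lengths of the partial products are required to be unbounded:
   a product of which only finitely many factors are nonempty is a finite word and hence is not
   equal to any infinite word x. *)
definition is_infinite_product :: "'a word \<Rightarrow> (nat \<Rightarrow> 'a list) \<Rightarrow> bool" where
  "is_infinite_product x W \<longleftrightarrow>
     (\<forall>n. concat (map W [0..<n]) = prefix (length (concat (map W [0..<n]))) x) \<and>
     (\<forall>m. \<exists>n. m \<le> length (concat (map W [0..<n])))"

(* The alphabet is the type 'a. If x is a word over a subset A of 'a, then every letter of U i and
   of V i occurs in x, so these words are automatically words over A. *)
definition self_shuffling :: "'a word \<Rightarrow> bool" where
  "self_shuffling x \<longleftrightarrow>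
     (\<exists>U V :: nat \<Rightarrow> 'a list.
        is_infinite_product x (\<lambda>i. U i @ V i) \<and>
        is_infinite_product x U \<and>
        is_infinite_product x V)"

(* For \<rho> = 1 the word is the limit as \<rho> tends to 1 from below: it starts with 1 and
   agrees with the word for \<rho> = 0 afterwards. The floor formula itself, taken at \<rho> = 1,
   would give the word for \<rho> = 0, which starts with 0. *)
definition sturmian :: "real \<Rightarrow> real \<Rightarrow> int word" where
  "sturmian \<alpha> \<rho> n =
     (if \<rho> = 1
      then (if n = 0 then 1 else \<lfloor>(real n + 1) * \<alpha>\<rfloor> - \<lfloor>real n * \<alpha>\<rfloor>)
      else \<lfloor>(real n + 1) * \<alpha> + \<rho>\<rfloor> - \<lfloor>real n * \<alpha> + \<rho>\<rfloor>)"

end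

theory Submission
  imports Defs
begin

text \<open>
  A self-shuffling of a word \<open>x\<close> is a lattice path in \<open>\<nat>\<^sup>2\<close> from the origin: the
  \<open>n\<close>-th letter of \<open>x\<close> is charged either to the first copy of \<open>x\<close>, a step of the first
  coordinate, or to the second copy, a step of the second coordinate, and both copies are used up
  precisely when both coordinates tend to infinity. That every letter is charged to an equal letter
  can be said without mentioning steps, through the partial sums \<open>S\<close> of \<open>x\<close>: it amounts to
  \<open>S n = S (i n) + S (j n)\<close> along the path. This is \<open>self_shuffling_iff_additive_path\<close>.

  For a Sturmian word with \<open>\<rho> < 1\<close> the partial sums telescope to \<open>\<lfloor>n \<alpha> + \<rho>\<rfloor>\<close>. Writing
  \<open>i \<alpha>\<close> and \<open>j \<alpha>\<close> as integer part plus fractional part, the integer parts cancel from the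
  additivity condition, and the carries that remain are the two sides of the arithmetic
  condition on the path (\<open>floor_add_iff_carries\<close>).

  For \<open>\<rho> = 1\<close> both sides of the equivalence are false. The arithmetic condition already fails at
  the origin, where it reads \<open>1 + 1 = 1\<close>. The word is not self-shuffling because its
  partial sums are \<open>\<lfloor>n \<alpha>\<rfloor> + 1\<close> for \<open>n > 0\<close>, so additivity at a point with both coordinates
  positive forces a carry in \<open>{i \<alpha>} + {j \<alpha>}\<close>, that is, \<open>{n \<alpha>} < {i \<alpha>}\<close>. This is
  impossible whenever \<open>{n \<alpha>}\<close> exceeds all earlier values, and such \<open>n\<close> are unbounded because
  the multiples of \<open>\<alpha>\<close> come arbitrarily close to \<open>1\<close> modulo \<open>1\<close>.
\<close>

section \<open>Self-shufflings as lattice paths\<close>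

definition unbounded_path :: "(nat \<Rightarrow> nat) \<Rightarrow> (nat \<Rightarrow> nat) \<Rightarrow> bool" where
  "unbounded_path i j \<longleftrightarrow>
     (\<forall>n. i n \<le> i (Suc n) \<and> j n \<le> j (Suc n) \<and> i n + j n = n) \<and>
     filterlim i at_top sequentially \<and> filterlim j at_top sequentially"

lemma unbounded_path_start:
  assumes "unbounded_path i j"
  shows "i 0 = 0" "j 0 = 0"
  using assms unfolding unbounded_path_def by (metis add_is_0)+

lemma unbounded_path_step:
  assumes "unbounded_path i j"
  shows "i (Suc n) = Suc (i n) \<and> j (Suc n) = j n \<or> i (Suc n) = i n \<and> j (Suc n) = Suc (j n)"
proof -
  have "i n \<le> i (Suc n)" "j n \<le> j (Suc n)" "i n + j n = n" "i (Suc n) + j (Suc n) = Suc n"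
    using assms unfolding unbounded_path_def by blast+
  then show ?thesis by linarith
qed

lemma filterlim_at_top_if_mono_unbounded:
  fixes f :: "nat \<Rightarrow> nat"
  assumes "mono f" and "\<And>m. \<exists>n. m \<le> f n"
  shows "filterlim f at_top sequentially"
  unfolding filterlim_at_top eventually_sequentially
  using assms by (meson le_trans monoD)

lemma unbounded_if_filterlim_at_top:
  fixes f :: "nat \<Rightarrow> nat"
  assumes "filterlim f at_top sequentially"
  shows "\<exists>n. m \<le> f n"
  using assms unfolding filterlim_at_top eventually_sequentially by blast

lemma length_concat_map_upt_Suc:
  "length (concat (map W [0..<Suc k])) = length (concat (map W [0..<k])) + length (W k)"
  by simp

lemma infinite_product_nth:
  assumes "is_infinite_product x W" and "m < length (W k)"
  shows "W k ! m = x (length (concat (map W [0..<k])) + m)"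
proof -
  let ?L = "\<lambda>k. length (concat (map W [0..<k]))"
  have "concat (map W [0..<Suc k]) ! (?L k + m) = prefix (?L (Suc k)) x ! (?L k + m)"
    using assms(1) unfolding is_infinite_product_def by metis
  moreover have "concat (map W [0..<Suc k]) ! (?L k + m) = W k ! m"
    by (simp add: nth_append)
  ultimately show ?thesis
    using assms(2) by (simp add: length_concat_map_upt_Suc del: upt_Suc)
qed

text \<open>The path reads off the shuffling letter by letter: position \<open>n\<close> belongs to the first
  coordinate exactly when it falls into a block \<open>U k\<close> of the product of the \<open>U k @ V k\<close>. Counting
  these positions gives the first coordinate, and counting the others gives the second.\<close>

lemma path_of_self_shuffling:
  assumes "self_shuffling x"
  obtains i j where "unbounded_path i j"
    and "\<And>n. x n = (if i (Suc n) = Suc (i n) then x (i n) else x (j n))"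
proof -
  obtain U V where UV: "is_infinite_product x (\<lambda>i. U i @ V i)"
    and U: "is_infinite_product x U" and V: "is_infinite_product x V"
    using assms unfolding self_shuffling_def by blast
  define A where "A k = length (concat (map U [0..<k]))" for k
  define B where "B k = length (concat (map V [0..<k]))" for k
  define L where "L k = length (concat (map (\<lambda>i. U i @ V i) [0..<k]))" for k
  have A_Suc: "A (Suc k) = A k + length (U k)" and B_Suc: "B (Suc k) = B k + length (V k)"
    and L_Suc: "L (Suc k) = L k + length (U k) + length (V k)" for k
    by (simp_all add: A_def B_def L_def)
  have zero: "A 0 = 0" "B 0 = 0" "L 0 = 0"
    by (simp_all add: A_def B_def L_def)
  have L_AB: "L k = A k + B k" for k
    by (induction k) (simp_all add: zero A_Suc B_Suc L_Suc)
  have L_mono: "mono L"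
    by (simp add: mono_iff_le_Suc L_Suc)
  have L_unb: "\<exists>k. n < L k" for n
    using UV unfolding is_infinite_product_def L_def by (meson Suc_le_eq)
  define first where "first m \<longleftrightarrow> (\<exists>k. L k \<le> m \<and> m < L k + length (U k))" for m
  \<comment> \<open>Blocks may be empty, so \<open>L\<close> need not be injective; but a position lies in one block only.\<close>
  have block_unique: "k = k'" if "L k \<le> m" "m < L (Suc k)" "L k' \<le> m" "m < L (Suc k')" for k k' m
  proof (rule ccontr)
    assume "k \<noteq> k'"
    then consider "Suc k \<le> k'" | "Suc k' \<le> k" by linarith
    then show False using monoD[OF L_mono] that by (meson leD le_trans)
  qed
  have first_iff: "first m \<longleftrightarrow> m < L k + length (U k)" if "L k \<le> m" "m < L (Suc k)" for k m
  proof
    assume "first m"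
    then obtain k' where k': "L k' \<le> m" "m < L k' + length (U k')"
      unfolding first_def by blast
    moreover have "k' = k"
      using block_unique[of k' m k] that k' by (simp add: L_Suc)
    ultimately show "m < L k + length (U k)" by simp
  qed (use that in \<open>auto simp: first_def\<close>)
  define i where "i n = (\<Sum>m<n. of_bool (first m) :: nat)" for n
  define j where "j n = (\<Sum>m<n. of_bool (\<not> first m) :: nat)" for n
  have i_0: "i 0 = 0" and j_0: "j 0 = 0"
    by (simp_all add: i_def j_def)
  have i_Suc: "i (Suc n) = i n + of_bool (first n)"
    and j_Suc: "j (Suc n) = j n + of_bool (\<not> first n)" for n
    by (simp_all add: i_def j_def)
  have i_j: "i n + j n = n" for n
    by (induction n) (simp_all add: i_0 j_0 i_Suc j_Suc)
  have in_U: "i (L k + m) = i (L k) + m" if "m \<le> length (U k)" for k m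
    using that
  proof (induction m)
    case (Suc m)
    then have "first (L k + m)"
      using first_iff[of k "L k + m"] by (simp add: L_Suc)
    then show ?case using Suc by (simp add: i_Suc)
  qed simp
  have in_V: "i (L k + length (U k) + m) = i (L k + length (U k))" if "m \<le> length (V k)" for k m
    using that
  proof (induction m)
    case (Suc m)
    then have "\<not> first (L k + length (U k) + m)"
      using first_iff[of k "L k + length (U k) + m"] by (simp add: L_Suc)
    then show ?case using Suc by (simp add: i_Suc)
  qed simp
  have i_L: "i (L k) = A k" for k
    by (induction k) (simp_all add: zero i_0 A_Suc L_Suc in_U in_V)
  have j_L: "j (L k) = B k" for k
    using i_j[of "L k"] i_L[of k] L_AB[of k] by simp
  have "mono i" "mono j"
    by (simp_all add: mono_iff_le_Suc i_Suc j_Suc)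
  moreover have "\<exists>n. m \<le> i n" for m
    using U i_L unfolding is_infinite_product_def A_def by metis
  moreover have "\<exists>n. m \<le> j n" for m
    using V j_L unfolding is_infinite_product_def B_def by metis
  ultimately have "unbounded_path i j"
    unfolding unbounded_path_def
    by (simp add: filterlim_at_top_if_mono_unbounded i_j i_Suc j_Suc)
  moreover have "x n = (if i (Suc n) = Suc (i n) then x (i n) else x (j n))" for n
  proof -
    have "\<exists>k. L k \<le> n \<and> n < L (Suc k)"
    proof -
      define k where "k = (LEAST k. n < L k)"
      have "n < L k" using L_unb[of n] unfolding k_def by (rule LeastI_ex)
      moreover from this obtain k' where "k = Suc k'"
        using zero by (cases k) auto
      moreover have "\<not> n < L k'"
        using not_less_Least[of k' "\<lambda>k. n < L k"] \<open>k = Suc k'\<close> unfolding k_def by simp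
      ultimately show ?thesis by (meson not_less)
    qed
    then obtain k where k: "L k \<le> n" "n < L (Suc k)" by blast
    define m where "m = n - L k"
    have n: "n = L k + m" and m: "m < length (U k @ V k)"
      using k by (simp_all add: m_def L_Suc)
    have x_n: "x n = (U k @ V k) ! m"
      using infinite_product_nth[OF UV m] by (simp add: n L_def)
    show ?thesis
    proof (cases "m < length (U k)")
      case True
      then have "first n" using first_iff[OF k] n by simp
      moreover have "i n = A k + m" using in_U[of m k] True n i_L by simp
      moreover have "U k ! m = x (A k + m)"
        using infinite_product_nth[OF U True] by (simp add: A_def)
      ultimately show ?thesis using True x_n by (simp add: nth_append i_Suc)
    next
      case False
      define l where "l = m - length (U k)"
      have l: "l < length (V k)" and n': "n = L k + length (U k) + l"
        using False m n by (simp_all add: l_def)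
      have "\<not> first n" using first_iff[OF k] n False by simp
      moreover have "i n = A k + length (U k)"
        using in_V[of l k] in_U[of "length (U k)" k] l n' i_L by simp
      then have "j n = B k + l" using i_j[of n] n' L_AB[of k] by simp
      moreover have "V k ! l = x (B k + l)"
        using infinite_product_nth[OF V l] by (simp add: B_def)
      ultimately show ?thesis using False x_n by (simp add: nth_append i_Suc l_def)
    qed
  qed
  ultimately show thesis by (rule that)
qed

text \<open>Conversely, each step of a path can be taken as a factor of its own: one of \<open>U n\<close> and
  \<open>V n\<close> is the letter \<open>x n\<close> and the other is empty.\<close>

lemma self_shuffling_of_path:
  assumes path: "unbounded_path i j"
    and letters: "\<And>n. x n = (if i (Suc n) = Suc (i n) then x (i n) else x (j n))"
  shows "self_shuffling x"
proof -
  define U where "U n = (if i (Suc n) = Suc (i n) then [x n] else [])" for n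
  define V where "V n = (if i (Suc n) = Suc (i n) then [] else [x n])" for n
  note step = unbounded_path_step[OF path]
  have concat_UV: "concat (map (\<lambda>n. U n @ V n) [0..<n]) = prefix n x" for n
    by (induction n) (simp_all add: U_def V_def subsequence_def)
  have concat_U: "concat (map U [0..<n]) = prefix (i n) x" for n
  proof (induction n)
    case (Suc n)
    then show ?case using step[of n] letters[of n] by (auto simp: U_def subsequence_def)
  qed (simp add: unbounded_path_start[OF path])
  have concat_V: "concat (map V [0..<n]) = prefix (j n) x" for n
  proof (induction n)
    case (Suc n)
    then show ?case using step[of n] letters[of n] by (auto simp: V_def subsequence_def)
  qed (simp add: unbounded_path_start[OF path])
  have lims: "filterlim i at_top sequentially" "filterlim j at_top sequentially"
    using path unfolding unbounded_path_def by blast+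
  have "is_infinite_product x (\<lambda>n. U n @ V n)"
    unfolding is_infinite_product_def concat_UV by auto
  moreover have "is_infinite_product x U"
    unfolding is_infinite_product_def concat_U
    using unbounded_if_filterlim_at_top[OF lims(1)] by simp
  moreover have "is_infinite_product x V"
    unfolding is_infinite_product_def concat_V
    using unbounded_if_filterlim_at_top[OF lims(2)] by simp
  ultimately show ?thesis
    unfolding self_shuffling_def by blast
qed

text \<open>One step changes both sides of the additivity condition by a single letter, so the condition
  propagates along the path precisely when these letters agree.\<close>

lemma letters_match_iff_additive:
  fixes x :: "nat \<Rightarrow> 'a :: ab_group_add"
  assumes path: "unbounded_path i j"
  shows "(\<forall>n. x n = (if i (Suc n) = Suc (i n) then x (i n) else x (j n))) \<longleftrightarrow>
    (\<forall>n. sum x {..<n} = sum x {..<i n} + sum x {..<j n})"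
proof (intro iffI allI)
  fix n
  assume letters: "\<forall>n. x n = (if i (Suc n) = Suc (i n) then x (i n) else x (j n))"
  show "sum x {..<n} = sum x {..<i n} + sum x {..<j n}"
  proof (induction n)
    case (Suc n)
    then show ?case
      using unbounded_path_step[OF path, of n] letters[rule_format, of n]
      by (auto simp: algebra_simps)
  qed (simp add: unbounded_path_start[OF path])
next
  fix n
  assume "\<forall>n. sum x {..<n} = sum x {..<i n} + sum x {..<j n}"
  from this[rule_format, of n] this[rule_format, of "Suc n"]
  show "x n = (if i (Suc n) = Suc (i n) then x (i n) else x (j n))"
    using unbounded_path_step[OF path, of n] by (auto simp: algebra_simps)
qed

lemma self_shuffling_iff_additive_path:
  fixes x :: "nat \<Rightarrow> 'a :: ab_group_add"
  shows "self_shuffling x \<longleftrightarrow>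
    (\<exists>i j. unbounded_path i j \<and> (\<forall>n. sum x {..<n} = sum x {..<i n} + sum x {..<j n}))"
proof
  assume "self_shuffling x"
  then obtain i j where "unbounded_path i j"
    and "\<And>n. x n = (if i (Suc n) = Suc (i n) then x (i n) else x (j n))"
    by (rule path_of_self_shuffling) blast
  then show "\<exists>i j. unbounded_path i j \<and> (\<forall>n. sum x {..<n} = sum x {..<i n} + sum x {..<j n})"
    using letters_match_iff_additive[of i j x] by blast
next
  assume "\<exists>i j. unbounded_path i j \<and> (\<forall>n. sum x {..<n} = sum x {..<i n} + sum x {..<j n})"
  then obtain i j where "unbounded_path i j"
    and "\<forall>n. sum x {..<n} = sum x {..<i n} + sum x {..<j n}"
    by blast
  then show "self_shuffling x"
    using letters_match_iff_additive[of i j x] self_shuffling_of_path[of i j x] by blast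
qed

section \<open>Partial sums of Sturmian words\<close>

lemma sum_sturmian:
  assumes "0 \<le> \<rho>" "\<rho> < 1"
  shows "sum (sturmian \<alpha> \<rho>) {..<n} = \<lfloor>real n * \<alpha> + \<rho>\<rfloor>"
proof (induction n)
  case 0
  show ?case using assms by (simp add: floor_eq_iff)
next
  case (Suc n)
  then show ?case using assms by (simp add: sturmian_def algebra_simps)
qed

lemma sum_sturmian_1:
  assumes "0 < \<alpha>" "\<alpha> < 1" "0 < n"
  shows "sum (sturmian \<alpha> 1) {..<n} = \<lfloor>real n * \<alpha>\<rfloor> + 1"
  using \<open>0 < n\<close>
proof (induction n rule: nat_induct_non_zero)
  case 1
  show ?case using assms by (simp add: sturmian_def floor_eq_iff)
next
  case (Suc n)
  then show ?case by (simp add: sturmian_def algebra_simps)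
qed

lemma floor_add_eq_floor_plus_carry:
  fixes x \<rho> :: real
  assumes "0 \<le> \<rho>" "\<rho> < 1"
  shows "\<lfloor>x + \<rho>\<rfloor> = \<lfloor>x\<rfloor> + of_bool (frac x \<ge> 1 - \<rho>)"
  using assms frac_lt_1[of x] by (auto simp: floor_eq_iff frac_def) linarith

text \<open>For \<open>\<rho> < 1\<close> the carry of \<open>frac x + \<rho>\<close> is \<open>0\<close> or \<open>1\<close>, which is why an indicator suffices
  for each single summand, while the carry of \<open>frac x + frac y + \<rho>\<close> may be \<open>2\<close>.\<close>

lemma floor_add_iff_carries:
  fixes x y \<rho> :: real
  assumes "0 \<le> \<rho>" "\<rho> < 1"
  shows "\<lfloor>x + y + \<rho>\<rfloor> = \<lfloor>x + \<rho>\<rfloor> + \<lfloor>y + \<rho>\<rfloor> \<longleftrightarrow>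
    of_bool (frac x \<ge> 1 - \<rho>) + of_bool (frac y \<ge> 1 - \<rho>) = \<lfloor>frac x + frac y + \<rho>\<rfloor>"
proof -
  have "x + y + \<rho> = (frac x + frac y + \<rho>) + of_int (\<lfloor>x\<rfloor> + \<lfloor>y\<rfloor>)"
    by (simp add: frac_def)
  then have "\<lfloor>x + y + \<rho>\<rfloor> = \<lfloor>frac x + frac y + \<rho>\<rfloor> + (\<lfloor>x\<rfloor> + \<lfloor>y\<rfloor>)"
    by (metis floor_add_int)
  then show ?thesis
    unfolding floor_add_eq_floor_plus_carry[OF assms] by linarith
qed

section \<open>The word of intercept one\<close>

lemma ex_frac_mult_greater:
  fixes \<alpha> c :: real
  assumes "\<alpha> \<notin> \<rat>" "c < 1"
  shows "\<exists>n. c < frac (real n * \<alpha>)"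
proof -
  have "0 < 1 - c" using assms(2) by simp
  then obtain n :: nat where "\<bar>frac (real n * \<alpha>) - 1\<bar> < 1 - c"
    using Kronecker_approx_1_explicit[OF assms(1), of 1 "1 - c"] by auto
  then have "c < frac (real n * \<alpha>)" by linarith
  then show ?thesis by blast
qed

text \<open>The least \<open>n\<close> whose value exceeds those at \<open>0, \<dots>, N\<close> is a record, and it lies
  beyond \<open>N\<close>.\<close>

lemma ex_frac_record:
  fixes \<alpha> :: real
  assumes "\<alpha> \<notin> \<rat>"
  shows "\<exists>n>N. \<forall>m<n. frac (real m * \<alpha>) < frac (real n * \<alpha>)"
proof -
  define c where "c = Max ((\<lambda>m. frac (real m * \<alpha>)) ` {..N})"
  have "c < 1" unfolding c_def by (simp add: frac_lt_1)
  define n where "n = (LEAST n. c < frac (real n * \<alpha>))"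
  have n: "c < frac (real n * \<alpha>)"
    using ex_frac_mult_greater[OF assms \<open>c < 1\<close>] unfolding n_def by (rule LeastI_ex)
  have "frac (real m * \<alpha>) \<le> c" if "m \<le> N" for m
    unfolding c_def using that by simp
  then have "N < n" using n by (meson not_less)
  moreover have "frac (real m * \<alpha>) < frac (real n * \<alpha>)" if "m < n" for m
    using not_less_Least[of m "\<lambda>n. c < frac (real n * \<alpha>)"] that n unfolding n_def by simp
  ultimately show ?thesis by blast
qed

text \<open>The exceptional first letter adds one to every nonempty partial sum. Where both coordinates
  are positive it is counted twice on one side of the additivity condition and once on the other,
  so a carry of the fractional parts has to make up for it. As long as one coordinate is zero the
  condition is vacuous, so only points late on the path give a contradiction.\<close>

lemma not_self_shuffling_sturmian_1:
  assumes "0 < \<alpha>" "\<alpha> < 1" "\<alpha> \<notin> \<rat>"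
  shows "\<not> self_shuffling (sturmian \<alpha> 1)"
proof
  assume "self_shuffling (sturmian \<alpha> 1)"
  then obtain i j where path: "unbounded_path i j"
    and additive: "\<And>n. sum (sturmian \<alpha> 1) {..<n} =
      sum (sturmian \<alpha> 1) {..<i n} + sum (sturmian \<alpha> 1) {..<j n}"
    unfolding self_shuffling_iff_additive_path by blast
  have "\<forall>\<^sub>F n in sequentially. 0 < i n \<and> 0 < j n"
    using path unfolding unbounded_path_def filterlim_at_top eventually_conj_iff Suc_le_eq[symmetric]
    by blast
  then obtain N where N: "\<And>n. N \<le> n \<Longrightarrow> 0 < i n \<and> 0 < j n"
    unfolding eventually_sequentially by blast
  obtain n where "N < n" and n_record: "\<And>m. m < n \<Longrightarrow> frac (real m * \<alpha>) < frac (real n * \<alpha>)"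
    using ex_frac_record[OF assms(3)] by blast
  have pos: "0 < i n" "0 < j n" and sum_ij: "i n + j n = n"
    using N[of n] \<open>N < n\<close> path unfolding unbounded_path_def by auto
  have "\<lfloor>real n * \<alpha>\<rfloor> = \<lfloor>real (i n) * \<alpha>\<rfloor> + \<lfloor>real (j n) * \<alpha>\<rfloor> + 1"
    using additive[of n] pos \<open>N < n\<close> assms by (simp add: sum_sturmian_1)
  moreover have "real n * \<alpha> = real (i n) * \<alpha> + real (j n) * \<alpha>"
    using sum_ij by (metis distrib_right of_nat_add)
  ultimately have "frac (real n * \<alpha>) = frac (real (i n) * \<alpha>) + frac (real (j n) * \<alpha>) - 1"
    by (simp add: frac_def)
  then have "frac (real n * \<alpha>) < frac (real (i n) * \<alpha>)"
    using frac_lt_1[of "real (j n) * \<alpha>"] by simp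
  moreover have "i n < n" using pos sum_ij by linarith
  ultimately show False using n_record[of "i n"] by simp
qed

section \<open>The characterization\<close>

theorem theorem6p5:
  fixes \<alpha> \<rho> :: real
  assumes "0 < \<alpha>" and "\<alpha> < 1" and "\<alpha> \<notin> \<rat>"
    and "0 \<le> \<rho>" and "\<rho> \<le> 1"
  shows "self_shuffling (sturmian \<alpha> \<rho>) \<longleftrightarrow>
    (\<exists>i j :: nat \<Rightarrow> nat.
       (\<forall>n. i n \<le> i (Suc n) \<and> j n \<le> j (Suc n) \<and> i n + j n = n) \<and>
       (filterlim i at_top sequentially \<and> filterlim j at_top sequentially) \<and>
       (\<forall>n. (of_bool (frac (real (i n) * \<alpha>) \<ge> 1 - \<rho>) :: int)
             + of_bool (frac (real (j n) * \<alpha>) \<ge> 1 - \<rho>)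
           = \<lfloor>frac (real (i n) * \<alpha>) + frac (real (j n) * \<alpha>) + \<rho>\<rfloor>))"
    (is "_ \<longleftrightarrow> (\<exists>i j. ?steps i j \<and> ?limits i j \<and> (\<forall>n. ?carries (i n) (j n)))")
proof -
  have paths: "(\<exists>i j. ?steps i j \<and> ?limits i j \<and> (\<forall>n. ?carries (i n) (j n))) \<longleftrightarrow>
      (\<exists>i j. unbounded_path i j \<and> (\<forall>n. ?carries (i n) (j n)))"
    unfolding unbounded_path_def by blast
  show ?thesis
  proof (cases "\<rho> = 1")
    case True
    have "\<not> ?carries 0 0" using True by simp
    then have "\<not> (\<exists>i j. unbounded_path i j \<and> (\<forall>n. ?carries (i n) (j n)))"
      by (metis unbounded_path_start)
    then show ?thesis
      using not_self_shuffling_sturmian_1[OF assms(1-3)] True paths by blast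
  next
    case False
    then have \<rho>: "0 \<le> \<rho>" "\<rho> < 1" using assms by simp_all
    let ?s = "sturmian \<alpha> \<rho>"
    have "sum ?s {..<n} = sum ?s {..<i n} + sum ?s {..<j n} \<longleftrightarrow> ?carries (i n) (j n)"
      if "unbounded_path i j" for i j n
    proof -
      have "i n + j n = n" using that unfolding unbounded_path_def by blast
      then have "real n * \<alpha> = real (i n) * \<alpha> + real (j n) * \<alpha>"
        by (metis distrib_right of_nat_add)
      then show ?thesis
        using floor_add_iff_carries[OF \<rho>] by (simp add: sum_sturmian \<rho>)
    qed
    then show ?thesis
      unfolding self_shuffling_iff_additive_path paths by blast
  qed
qed

end
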